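(* Let $N$ be a positive integer. The function $f_{N+1,N}(u)$ satisfies the second-order differential equation $$\begin{aligned}\Bigl(\frac{uN}{u-1}+\frac 12\Bigr)\frac{\partial^2 f_{N+1,N}}{\partial u^2}=&\ \frac{-8u^2N^2 +(-8u^2+4u)N -(u-1)^2}{2u(u^2-1)(u-1)}\,\frac{\partial f_{N+1,N}}{\partial u}\\&+\frac{2N(N+1)}{(u^2-1)(u-1)}\,f_{N+1,N}-\frac{N(N+1)}{(u^2-1)(u-1)}\end{aligned}$$ (for all complex $u\notin\{0,1,-1\}$).
   Context: For nonnegative integers $A,B$ and complex $u\ne1$, $$f_{A,B}(u):=\frac1{2\pi i}\oint_{C_0}dz\,\Bigl(1+\frac1{u+z-1}\Bigr)^A\Bigl(1-\frac1z\Bigr)^B,$$ where $C_0$ is a small positively oriented contour encircling $z=0$ but not $z=1-u$ (i.e. $f_{A,B}(u)$ is the residue of the integrand at $z=0$; it is a rational function of $u$). *)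

theory Defs
  imports "HOL-Complex_Analysis.Complex_Analysis"
begin

definition f_integrand :: "nat \<Rightarrow> nat \<Rightarrow> complex \<Rightarrow> complex \<Rightarrow> complex" where
  "f_integrand A B u z = (1 + 1 / (u + z - 1)) ^ A * (1 - 1 / z) ^ B"

text \<open>Only meaningful for \<open>u \<noteq> 1\<close>; at \<open>u = 1\<close> the two poles of the integrand collide.\<close>

definition f_AB :: "nat \<Rightarrow> nat \<Rightarrow> complex \<Rightarrow> complex" where
  "f_AB A B u = residue (f_integrand A B u) 0"

text \<open>The residue is the contour integral along any circle around \<open>0\<close> that does not
  enclose \<open>1 - u\<close>.\<close>

lemma f_AB_eq_contour_integral:
  assumes "0 < r" and "r < cmod (1 - u)"
  shows "f_AB A B u =
    1 / (2 * of_real pi * \<i>) * contour_integral (circlepath 0 r) (f_integrand A B u)"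
proof -
  have nz: "u + z - 1 \<noteq> 0" if "z \<in> ball 0 (cmod (1 - u)) - {0}" for z
  proof
    assume "u + z - 1 = 0"
    then have "z = 1 - u" by (simp add: algebra_simps)
    with that show False by simp
  qed
  have "f_integrand A B u holomorphic_on (ball 0 (cmod (1 - u)) - {0})"
    unfolding f_integrand_def by (intro holomorphic_intros) (use nz in auto)
  then have "(f_integrand A B u has_contour_integral
      2 * pi * \<i> * residue (f_integrand A B u) 0) (circlepath 0 r)"
    using assms by (intro base_residue[of "ball 0 (cmod (1 - u))"]) auto
  then show ?thesis
    by (simp add: f_AB_def contour_integral_unique)
qed

end

theory Submission
  imports Defs
begin

text \<open>
  Write \<open>w = u + z - 1\<close> and \<open>P = (1 + 1 / w) ^ N * (1 - 1 / z) ^ N = (1 - u / (w * z)) ^ N\<close>. Since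
  \<open>1 / w = ((1 / w + 1 / z) + (1 - u) / (w * z)) / 2\<close>, the function \<open>f\<close> is a combination of the
  residues of \<open>P\<close>, \<open>P / (w * z)\<close> and \<open>P * (1 / w + 1 / z)\<close>. The last one is constant in \<open>u\<close> and
  equals \<open>1\<close> at \<open>u = 0\<close>, where \<open>P = 1\<close>. The first two satisfy a linear system of two first-order
  differential equations: modulo \<open>z\<close>-derivatives, which have no residue, the \<open>u\<close>-derivatives of
  \<open>P\<close> and \<open>P / (w * z)\<close> are combinations of \<open>P\<close> and \<open>P / (w * z)\<close>. Eliminating one unknown
  gives the second-order equation.
\<close>

section \<open>Residues modulo derivatives\<close>

text \<open>A single-valued primitive \<open>G\<close> on the punctured neighbourhood makes the
  integral over a small closed circle vanish.\<close>

lemma residue_deriv_eq_0: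
  assumes "open S" "0 \<in> S" "f holomorphic_on S - {0}"
    and G: "\<And>z. z \<in> S - {0} \<Longrightarrow> (G has_field_derivative f z) (at z)"
  shows "residue f 0 = 0"
proof -
  obtain r where r: "r > 0" "cball 0 r \<subseteq> S"
    using assms(1,2) by (auto simp: open_contains_cball)
  have "(f has_contour_integral 2 * pi * \<i> * residue f 0) (circlepath 0 r)"
    using assms r by (intro base_residue[of S]) auto
  moreover have "(f has_contour_integral 0) (circlepath 0 r)"
  proof (rule Cauchy_theorem_primitive[where S = "S - {0}" and f = G])
    show "(G has_field_derivative f z) (at z within S - {0})" if "z \<in> S - {0}" for z
      using G[OF that] by (rule has_field_derivative_at_within)
    show "path_image (circlepath 0 r) \<subseteq> S - {0}"
      using r by auto
  qed auto
  ultimately show ?thesis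
    using has_contour_integral_unique by fastforce
qed

text \<open>This is the form in which telescoping is used: \<open>G\<close> certifies that
  \<open>h\<close> agrees with \<open>a * f + b * g\<close> modulo a
  \<open>z\<close>-derivative.\<close>

lemma residue_eq_linear_combination:
  assumes S: "open S" "0 \<in> S"
    and hol: "f holomorphic_on S - {0}" "g holomorphic_on S - {0}" "h holomorphic_on S - {0}"
    and G: "\<And>z. z \<in> S - {0} \<Longrightarrow> (G has_field_derivative h z - (a * f z + b * g z)) (at z)"
  shows "residue h 0 = a * residue f 0 + b * residue g 0"
proof -
  have "residue (\<lambda>z. h z - (a * f z + b * g z)) 0 = 0"
    by (rule residue_deriv_eq_0[OF S _ G]) (intro holomorphic_intros hol)
  moreover have "residue (\<lambda>z. h z - (a * f z + b * g z)) 0 =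
      residue h 0 - residue (\<lambda>z. a * f z + b * g z) 0"
    by (rule residue_diff[OF S]) (intro holomorphic_intros hol)+
  moreover have "residue (\<lambda>z. a * f z + b * g z) 0 =
      residue (\<lambda>z. a * f z) 0 + residue (\<lambda>z. b * g z) 0"
    by (rule residue_add[OF S]) (intro holomorphic_intros hol)+
  ultimately show ?thesis
    using residue_lmul[OF S hol(1), of a] residue_lmul[OF S hol(2), of b] by simp
qed

section \<open>Differentiating a residue in a parameter\<close>

text \<open>The parameter enters only through the argument of \<open>\<phi>\<close>, so
  differentiation in \<open>u\<close> merely replaces \<open>\<phi>\<close> by
  \<open>deriv \<phi>\<close>.\<close>

definition shift_residue :: "(complex \<Rightarrow> complex) \<Rightarrow> (complex \<Rightarrow> complex) \<Rightarrow> complex \<Rightarrow> complex" where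
  "shift_residue \<phi> \<psi> u = residue (\<lambda>z. \<phi> (u + z - 1) * \<psi> z) 0"

lemma shift_holomorphic:
  assumes "\<phi> holomorphic_on - {0}" "\<psi> holomorphic_on - {0}"
  shows "(\<lambda>z. \<phi> (u + z - 1) * \<psi> z) holomorphic_on - {1 - u} - {0}"
proof -
  have "(\<lambda>z. \<phi> (u + z - 1)) holomorphic_on - {1 - u} - {0}"
    by (rule holomorphic_on_compose_gen[OF _ assms(1), unfolded o_def])
      (auto intro!: holomorphic_intros simp: algebra_simps)
  moreover have "\<psi> holomorphic_on - {1 - u} - {0}"
    by (rule holomorphic_on_subset[OF assms(2)]) auto
  ultimately show ?thesis
    by (intro holomorphic_intros)
qed

text \<open>Near \<open>u\<close> the residue is an integral over one fixed circle, and the Leibniz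
  rule differentiates under the integral sign.\<close>

lemma has_field_derivative_shift_residue:
  assumes \<phi>: "\<phi> holomorphic_on - {0}" and \<psi>: "\<psi> holomorphic_on - {0}" and "u \<noteq> 1"
  shows "(shift_residue \<phi> \<psi> has_field_derivative shift_residue (deriv \<phi>) \<psi> u) (at u)"
proof -
  \<comment> \<open>Half the distance from \<open>0\<close> to the pole \<open>1 - u\<close>: for
    \<open>v\<close> within \<open>r\<close> of \<open>u\<close>, the pole \<open>1 - v\<close>
    stays outside the closed disc of radius \<open>r\<close>.\<close>
  define r where "r = cmod (1 - u) / 2"
  have r: "r > 0" using \<open>u \<noteq> 1\<close> by (simp add: r_def)
  have nz: "v + z - 1 \<noteq> 0" if "v \<in> ball u r" "norm z \<le> r" for v z
  proof
    assume "v + z - 1 = 0"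
    then have "1 - u = (v - u) + z" by (simp add: algebra_simps)
    then have "cmod (1 - u) \<le> cmod (v - u) + cmod z"
      by (metis norm_triangle_ineq)
    with that show False
      by (simp add: r_def dist_norm norm_minus_commute)
  qed
  have d\<phi>: "deriv \<phi> holomorphic_on - {0}"
    by (rule holomorphic_deriv[OF \<phi>]) auto
  define c where "c t = circlepath 0 r t" for t :: real
  define c' where "c' t = vector_derivative (circlepath 0 r) (at t)" for t :: real
  have c: "norm (c t) = r" for t
    using r by (simp add: c_def circlepath norm_mult)
  have c0: "c t \<noteq> 0" for t
    using c[of t] r by auto
  have contc: "continuous_on X c" for X
    unfolding c_def circlepath by (intro continuous_intros)
  have contc': "continuous_on X c'" for X
    unfolding c'_def vector_derivative_circlepath by (intro continuous_intros)
  \<comment> \<open>Stated for arbitrary \<open>\<eta>\<close> because it is needed both for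
    \<open>\<phi>\<close> and for \<open>deriv \<phi>\<close>.\<close>
  have int: "((\<lambda>t. \<eta> (v + c t - 1) * \<psi> (c t) * c' t)
        has_integral (2 * pi * \<i> * shift_residue \<eta> \<psi> v)) (cbox 0 1)"
    if \<eta>: "\<eta> holomorphic_on - {0}" and v: "v \<in> ball u r" for \<eta> v
  proof -
    have "((\<lambda>z. \<eta> (v + z - 1) * \<psi> z) has_contour_integral (2 * pi * \<i> * shift_residue \<eta> \<psi> v))
        (circlepath 0 r)"
      unfolding shift_residue_def
    proof (rule base_residue[of "- {1 - v}"])
      show "(\<lambda>z. \<eta> (v + z - 1) * \<psi> z) holomorphic_on - {1 - v} - {0}"
        by (rule shift_holomorphic[OF \<eta> \<psi>])
      show "0 \<in> - {1 - v}" using nz[OF v, of 0] r by auto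
      show "cball 0 r \<subseteq> - {1 - v}" using nz[OF v, of "1 - v"] by auto
    qed (use r in auto)
    then show ?thesis
      unfolding has_contour_integral c_def c'_def by simp
  qed
  have "((\<lambda>v. integral (cbox 0 1) (\<lambda>t. \<phi> (v + c t - 1) * \<psi> (c t) * c' t)) has_field_derivative
      integral (cbox 0 1) (\<lambda>t. deriv \<phi> (u + c t - 1) * \<psi> (c t) * c' t)) (at u within ball u r)"
  proof (rule leibniz_rule_field_derivative)
    fix v t assume v: "v \<in> ball u r"
    have "(\<phi> has_field_derivative deriv \<phi> (v + c t - 1)) (at (v + c t - 1))"
      by (rule holomorphic_derivI[OF \<phi>]) (use nz[OF v, of "c t"] c[of t] in auto)
    then have "((\<lambda>v. \<phi> (v + c t - 1)) has_field_derivative deriv \<phi> (v + c t - 1)) (at v)"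
      by (rule DERIV_chain2[THEN DERIV_cong]) (auto intro!: derivative_eq_intros)
    then have "((\<lambda>v. \<phi> (v + c t - 1) * (\<psi> (c t) * c' t)) has_field_derivative
        deriv \<phi> (v + c t - 1) * (\<psi> (c t) * c' t)) (at v)"
      by (rule DERIV_cmult_right)
    then show "((\<lambda>v. \<phi> (v + c t - 1) * \<psi> (c t) * c' t) has_field_derivative
        deriv \<phi> (v + c t - 1) * \<psi> (c t) * c' t) (at v within ball u r)"
      by (simp add: mult.assoc has_field_derivative_at_within)
  next
    fix v assume "v \<in> ball u r"
    then show "(\<lambda>t. \<phi> (v + c t - 1) * \<psi> (c t) * c' t) integrable_on cbox 0 1"
      using int[OF \<phi>] by blast
  next
    have "continuous_on (ball u r \<times> cbox 0 1) (\<lambda>x. deriv \<phi> (fst x + c (snd x) - 1))"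
      by (rule continuous_on_compose2[OF holomorphic_on_imp_continuous_on[OF d\<phi>]])
        (use nz c in \<open>auto intro!: continuous_intros continuous_on_compose2[OF contc]\<close>)
    moreover have "continuous_on (ball u r \<times> cbox 0 1) (\<lambda>x. \<psi> (c (snd x)))"
      by (rule continuous_on_compose2[OF holomorphic_on_imp_continuous_on[OF \<psi>]])
        (use c0 in \<open>auto intro!: continuous_intros continuous_on_compose2[OF contc]\<close>)
    ultimately show "continuous_on (ball u r \<times> cbox 0 1)
        (\<lambda>(v, t). deriv \<phi> (v + c t - 1) * \<psi> (c t) * c' t)"
      unfolding split_beta
      by (intro continuous_intros continuous_on_compose2[OF contc']) auto
  qed (use r in auto)
  then have "((\<lambda>v. integral (cbox 0 1) (\<lambda>t. \<phi> (v + c t - 1) * \<psi> (c t) * c' t))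
      has_field_derivative
      integral (cbox 0 1) (\<lambda>t. deriv \<phi> (u + c t - 1) * \<psi> (c t) * c' t)) (at u)"
    using r at_within_open[of u "ball u r"] by simp
  from DERIV_cdivide[OF this, of "2 * pi * \<i>"]
  have "((\<lambda>v. integral (cbox 0 1) (\<lambda>t. \<phi> (v + c t - 1) * \<psi> (c t) * c' t) / (2 * pi * \<i>))
      has_field_derivative
      integral (cbox 0 1) (\<lambda>t. deriv \<phi> (u + c t - 1) * \<psi> (c t) * c' t) / (2 * pi * \<i>)) (at u)" .
  moreover have "integral (cbox 0 1) (\<lambda>t. deriv \<phi> (u + c t - 1) * \<psi> (c t) * c' t) / (2 * pi * \<i>) =
      shift_residue (deriv \<phi>) \<psi> u"
    using integral_unique[OF int[OF d\<phi>, of u]] r by simp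
  moreover have "integral (cbox 0 1) (\<lambda>t. \<phi> (v + c t - 1) * \<psi> (c t) * c' t) / (2 * pi * \<i>) =
      shift_residue \<phi> \<psi> v" if "v \<in> ball u r" for v
    using integral_unique[OF int[OF \<phi> that]] by simp
  ultimately show ?thesis
    using r by (auto elim!: has_field_derivative_transform_within_open[where S = "ball u r"])
qed

section \<open>The two factors of the integrand and their moments\<close>

text \<open>One function covers both factors, since
  \<open>1 - 1 / z = 1 + 1 / (- z)\<close>.\<close>

definition pole_fun :: "nat \<Rightarrow> nat \<Rightarrow> complex \<Rightarrow> complex" where
  "pole_fun N i w = (1 + 1 / w) ^ N / w ^ i"

lemma pole_fun_holomorphic: "pole_fun N i holomorphic_on - {0}"
  unfolding pole_fun_def by (intro holomorphic_intros) auto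

lemma pole_fun_eq: "pole_fun N i w = pole_fun N 0 w / w ^ i"
  by (simp add: pole_fun_def)

lemma pole_fun_minus_holomorphic: "(\<lambda>z. pole_fun N i (- z)) holomorphic_on - {0}"
  unfolding pole_fun_def by (intro holomorphic_intros) auto

text \<open>Logarithmic differentiation: \<open>1 + 1 / w\<close> has logarithmic derivative
  \<open>- 1 / (w * (w + 1))\<close>, and \<open>1 / w ^ i\<close> has
  \<open>- i / w\<close>.\<close>

lemma has_field_derivative_pole_fun:
  assumes "w \<noteq> 0" "w \<noteq> -1"
  shows "(pole_fun N i has_field_derivative
    - pole_fun N i w * (of_nat N / (w + 1) + of_nat i) / w) (at w)"
proof -
  have 1: "1 + 1 / w = (w + 1) / w" "w + 1 \<noteq> 0"
    using assms by (auto simp: field_simps add_eq_0_iff)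
  have P: "((\<lambda>w. (1 + 1 / w) ^ N) has_field_derivative
      (- ((1 + 1 / w) ^ N * of_nat N / (w * (w + 1))))) (at w)"
  \<comment> \<open>The power rule produces the exponent \<open>N - Suc 0\<close>, which is
    truncated at \<open>N = 0\<close>.\<close>
  proof (cases N)
    case (Suc n)
    have D: "((\<lambda>w. 1 + 1 / w) has_field_derivative - 1 / (w * w)) (at w)"
      using assms by (auto intro!: derivative_eq_intros)
    define y where "y = (1 + 1 / w) ^ n"
    have "(1 + 1 / w) ^ N = (w + 1) / w * y" "(1 + 1 / w) ^ (N - Suc 0) = y"
      using Suc 1 by (simp_all add: y_def)
    then show ?thesis
      by (intro DERIV_cong[OF DERIV_power[OF D, of N]]) (use assms 1(2) in simp)
  qed auto
  have Q: "((\<lambda>w. 1 / w ^ i) has_field_derivative (- (of_nat i / (w * w ^ i)))) (at w)"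
  proof (cases i)
    case (Suc n)
    have "((\<lambda>w. 1 / w) has_field_derivative - 1 / (w * w)) (at w)"
      using assms by (auto intro!: derivative_eq_intros)
    from DERIV_power[OF this, of i] show ?thesis
      using assms by (simp add: Suc power_divide mult.assoc)
  qed auto
  have "pole_fun N i = (\<lambda>w. (1 + 1 / w) ^ N * (1 / w ^ i))"
    by (simp add: pole_fun_def fun_eq_iff)
  moreover have "- (A * n / (w * (w + 1))) * (1 / B) + - (k / (w * B)) * A =
      - (A / B) * (n / (w + 1) + k) / w" if "B \<noteq> 0" for A B n k
    using that assms(1) 1(2) by (simp add: divide_simps) (simp add: algebra_simps)
  ultimately show ?thesis
    using DERIV_mult[OF P Q] assms by (simp add: pole_fun_def)
qed

lemmas deriv_pole_fun = DERIV_imp_deriv[OF has_field_derivative_pole_fun]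

text \<open>\<open>mom N i j u\<close> is the residue at \<open>z = 0\<close> of
  \<open>(1 + 1 / w) ^ N * (1 - 1 / z) ^ N / (w ^ i * (- z) ^ j)\<close> with \<open>w = u + z - 1\<close>.\<close>

definition mom :: "nat \<Rightarrow> nat \<Rightarrow> nat \<Rightarrow> complex \<Rightarrow> complex" where
  "mom N i j = shift_residue (pole_fun N i) (\<lambda>z. pole_fun N j (- z))"

definition dmom :: "nat \<Rightarrow> nat \<Rightarrow> nat \<Rightarrow> complex \<Rightarrow> complex" where
  "dmom N i j = shift_residue (deriv (pole_fun N i)) (\<lambda>z. pole_fun N j (- z))"

lemma has_field_derivative_mom:
  assumes "u \<noteq> 1"
  shows "(mom N i j has_field_derivative dmom N i j u) (at u)"
  unfolding mom_def dmom_def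
  by (rule has_field_derivative_shift_residue[OF pole_fun_holomorphic pole_fun_minus_holomorphic assms])

section \<open>The first-order system for the moments\<close>

context
  fixes N :: nat and u :: complex and S P w
  assumes u: "u \<noteq> 0" "u \<noteq> 1"
  defines "S \<equiv> - {1, 1 - u, - u}"
  defines "w \<equiv> \<lambda>z. u + z - 1"
  defines "P \<equiv> \<lambda>z. pole_fun N 0 (w z) * pole_fun N 0 (- z)"
begin

text \<open>Besides the pole \<open>1 - u\<close>, the set \<open>S\<close> omits \<open>1\<close>
  and \<open>- u\<close>, the zeros of \<open>1 - 1 / z\<close> and \<open>1 + 1 / w\<close>, where
  logarithmic derivatives break down. The conditions on \<open>u\<close> keep \<open>0\<close> in
  \<open>S\<close>.\<close>

lemma S: "open S" "0 \<in> S"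
  using u by (auto simp: S_def)

lemma S_D:
  assumes "z \<in> S - {0}"
  shows "z \<noteq> 0" "w z \<noteq> 0" "w z + 1 \<noteq> 0" "z - 1 \<noteq> 0"
  using assms by (auto simp: S_def w_def algebra_simps eq_neg_iff_add_eq_0)

lemma has_field_derivative_w: "(w has_field_derivative 1) (at z)"
  unfolding w_def by (auto intro!: derivative_eq_intros)

lemma has_field_derivative_inverse_w:
  assumes "w z \<noteq> 0"
  shows "((\<lambda>z. 1 / w z) has_field_derivative - 1 / (w z * w z)) (at z)"
  using DERIV_inverse'[OF has_field_derivative_w assms] by (simp add: divide_inverse)

text \<open>The logarithmic derivatives of the two factors add up to a single fraction whose
  numerator factors: \<open>w * (w + 1) - z * (z - 1) = (w + z) * (w - z + 1)\<close>, and
  \<open>w - z + 1 = u\<close>.\<close>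

lemma has_field_derivative_P:
  assumes z: "z \<in> S - {0}"
  shows "(P has_field_derivative
    P z * of_nat N * u * (w z + z) / (w z * (w z + 1) * z * (z - 1))) (at z)"
proof -
  note z' = S_D[OF z]
  have 1: "((\<lambda>z. pole_fun N 0 (w z)) has_field_derivative
      - pole_fun N 0 (w z) * (of_nat N / (w z + 1) + of_nat 0) / w z * 1) (at z)"
    by (rule DERIV_chain2[OF has_field_derivative_pole_fun has_field_derivative_w])
      (use z' in \<open>auto simp: add_eq_0_iff\<close>)
  have 2: "((\<lambda>z. pole_fun N 0 (- z)) has_field_derivative
      - pole_fun N 0 (- z) * (of_nat N / (- z + 1) + of_nat 0) / (- z) * (- 1)) (at z)"
    by (rule DERIV_chain2[OF has_field_derivative_pole_fun])
      (use z' in \<open>auto intro!: derivative_eq_intros\<close>)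
  have *: "- (n / (W + 1)) / W - n / ((1 - z) * z) =
        n * u * (W + z) / (W * (W + 1) * z * (z - 1))"
    if "W = u + z - 1" "W \<noteq> 0" "W + 1 \<noteq> 0" for n W
  proof -
    have "u = W - z + 1" using that by simp
    moreover have "1 - z \<noteq> 0" using z' by auto
    ultimately show ?thesis
      using that(2,3) z'(1,4) by (simp add: divide_simps) (simp add: algebra_simps)
  qed
  have "- (of_nat N / (w z + 1)) / w z - of_nat N / ((1 - z) * z) =
        of_nat N * u * (w z + z) / (w z * (w z + 1) * z * (z - 1))"
    by (rule *) (use z' in \<open>auto simp: w_def\<close>)
  then have "P z * (- (of_nat N / (w z + 1)) / w z - of_nat N / ((1 - z) * z)) =
      P z * (of_nat N * u * (w z + z) / (w z * (w z + 1) * z * (z - 1)))"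
    by simp
  then show ?thesis
    using DERIV_mult[OF 1 2] unfolding P_def
    by (elim DERIV_cong) (simp add: algebra_simps)
qed

lemma mom_eq: "mom N i j u = residue (\<lambda>z. P z / (w z ^ i * (- z) ^ j)) 0"
  unfolding mom_def shift_residue_def P_def w_def
  by (subst pole_fun_eq, subst (2) pole_fun_eq) simp

lemma dmom_eq: "dmom N i j u = residue (\<lambda>z. deriv (pole_fun N i) (w z) * pole_fun N j (- z)) 0"
  unfolding dmom_def shift_residue_def w_def ..

lemma mom_holomorphic: "(\<lambda>z. P z / (w z ^ i * (- z) ^ j)) holomorphic_on S - {0}"
proof -
  have "(\<lambda>z. P z / (w z ^ i * (- z) ^ j)) = (\<lambda>z. pole_fun N i (u + z - 1) * pole_fun N j (- z))"
    unfolding P_def w_def by (subst (3) pole_fun_eq, subst (4) pole_fun_eq) simp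
  then show ?thesis
    using shift_holomorphic[OF pole_fun_holomorphic pole_fun_minus_holomorphic, of N i u N j]
    by (auto simp: S_def intro: holomorphic_on_subset)
qed

lemma dmom_holomorphic:
  "(\<lambda>z. deriv (pole_fun N i) (w z) * pole_fun N j (- z)) holomorphic_on S - {0}"
  unfolding w_def
  by (rule holomorphic_on_subset[OF shift_holomorphic])
    (auto simp: S_def intro!: holomorphic_deriv pole_fun_holomorphic pole_fun_minus_holomorphic)

lemma dmom_integrand:
  assumes z: "z \<in> S - {0}"
  shows "deriv (pole_fun N i) (w z) * pole_fun N j (- z) =
    - P z * (of_nat N / (w z + 1) + of_nat i) / (w z ^ Suc i * (- z) ^ j)"
proof -
  have "w z \<noteq> -1"
    using S_D[OF z] by auto
  then show ?thesis
    using S_D[OF z] unfolding P_def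
    by (simp add: deriv_pole_fun pole_fun_eq[of N i] pole_fun_eq[of N j] mult_ac)
qed

text \<open>The primitives in the next two lemmas come from creative telescoping in the variable
  \<open>t = w * z\<close> at fixed \<open>w + z\<close>, where \<open>P = (1 - u / t) ^ N\<close>. Up to sign they are
  \<open>P * (1 / (2 * t ^ i) + (w + z) * (a + b / t))\<close> with \<open>i = 0\<close> and \<open>i = 1\<close>, where \<open>a\<close> and \<open>b\<close> are
  chosen to cancel the pole at \<open>t = u\<close> and the double pole at \<open>t = 0\<close>.\<close>

lemma dmom_00:
  assumes "u \<noteq> -1"
  shows "dmom N 0 0 u = mom N 0 0 u / (u + 1) - of_nat N * (u - 1) / (u + 1) * mom N 1 1 u"
proof -
  have u1: "u + 1 \<noteq> 0" using assms by (simp add: add_eq_0_iff2)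
  have "dmom N 0 0 u = 1 / (u + 1) * mom N 0 0 u + - (of_nat N * (u - 1) / (u + 1)) * mom N 1 1 u"
    unfolding dmom_eq mom_eq
  proof (rule residue_eq_linear_combination[OF S mom_holomorphic mom_holomorphic dmom_holomorphic])
    fix z assume z: "z \<in> S - {0}"
    note z' = S_D[OF z]
    define n where "n = (of_nat N :: complex)"
    have u_eq: "u = w z - z + 1" by (simp add: w_def)
    \<comment> \<open>Since \<open>u + 1 - (w + z) = 2 * (1 - z)\<close>, this is the case
      \<open>a = - 1 / (2 * (u + 1))\<close>, \<open>b = 0\<close>.\<close>
    show "((\<lambda>z. P z * (1 / (u + 1) * (1 - z))) has_field_derivative
        deriv (pole_fun N 0) (w z) * pole_fun N 0 (- z) -
        (1 / (u + 1) * (P z / (w z ^ 0 * (- z) ^ 0)) +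
         - (of_nat N * (u - 1) / (u + 1)) * (P z / (w z ^ 1 * (- z) ^ 1)))) (at z)"
      unfolding dmom_integrand[OF z]
    proof (rule DERIV_cong[OF DERIV_mult[OF has_field_derivative_P[OF z]
          DERIV_cmult[OF DERIV_diff[OF DERIV_const DERIV_ident]]]], goal_cases)
      case 1
      show ?case
        unfolding n_def[symmetric] using z' u1
        by (simp add: divide_simps) (use u_eq in algebra)
    qed
  qed
  then show ?thesis by simp
qed

lemma dmom_11:
  assumes "u \<noteq> -1"
  shows "dmom N 1 1 u = 2 / (u * (u - 1) * (u + 1)) * mom N 0 0 u
    - (4 * of_nat N + u + 1) / ((u - 1) * (u + 1)) * mom N 1 1 u"
proof -
  have u1: "u + 1 \<noteq> 0" "u - 1 \<noteq> 0" using assms u by (auto simp: add_eq_0_iff2)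
  have "dmom N 1 1 u = 2 / (u * (u - 1) * (u + 1)) * mom N 0 0 u +
      - ((4 * of_nat N + u + 1) / ((u - 1) * (u + 1))) * mom N 1 1 u"
    unfolding dmom_eq mom_eq
  proof (rule residue_eq_linear_combination[OF S mom_holomorphic mom_holomorphic dmom_holomorphic])
    fix z assume z: "z \<in> S - {0}"
    note z' = S_D[OF z]
    define n where "n = (of_nat N :: complex)"
    have u_eq: "u = w z - z + 1" by (simp add: w_def)
    \<comment> \<open>By \<open>w - z = u - 1\<close>,
      \<open>1 / w = ((w + z) - (u - 1)) / (2 * t)\<close>. So this is the negative of the form with
      \<open>a = 1 / (u * (u - 1) * (u + 1))\<close>,
      \<open>b = - 1 / (2 * (u - 1))\<close>.\<close>
    show "((\<lambda>z. P z * (1 / (u - 1) * (1 / w z) - 1 / (u * (u - 1) * (u + 1)) * (w z + z)))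
        has_field_derivative
        deriv (pole_fun N 1) (w z) * pole_fun N 1 (- z) -
        (2 / (u * (u - 1) * (u + 1)) * (P z / (w z ^ 0 * (- z) ^ 0)) +
         - ((4 * of_nat N + u + 1) / ((u - 1) * (u + 1))) * (P z / (w z ^ 1 * (- z) ^ 1)))) (at z)"
      unfolding dmom_integrand[OF z]
    proof (rule DERIV_cong[OF DERIV_mult[OF has_field_derivative_P[OF z] DERIV_diff[OF
          DERIV_cmult[OF has_field_derivative_inverse_w[OF z'(2)]]
          DERIV_cmult[OF DERIV_add[OF has_field_derivative_w DERIV_ident]]]]], goal_cases)
      case 1
      show ?case
        unfolding n_def[symmetric] using z' u1 u
        by (simp add: divide_simps) (use u_eq in algebra)
    qed
  qed
  then show ?thesis by simp
qed

text \<open>This makes \<open>mom N 1 0 - mom N 0 1\<close> locally constant in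
  \<open>u\<close>.\<close>

lemma dmom_10: "dmom N 1 0 u = dmom N 0 1 u"
proof -
  have "dmom N 1 0 u = 1 * dmom N 0 1 u + 0 * dmom N 0 1 u"
    unfolding dmom_eq
  proof (rule residue_eq_linear_combination[OF S dmom_holomorphic dmom_holomorphic dmom_holomorphic])
    fix z assume z: "z \<in> S - {0}"
    note z' = S_D[OF z]
    define n where "n = (of_nat N :: complex)"
    have u_eq: "u = w z - z + 1" by (simp add: w_def)
    \<comment> \<open>Here \<open>1 / w - 1 / u = (1 - z) / (u * w)\<close>, which cancels the
      factor \<open>z - 1\<close> in the denominator of the derivative of \<open>P\<close>.\<close>
    show "((\<lambda>z. P z * (1 / w z - 1 / u)) has_field_derivative
        deriv (pole_fun N 1) (w z) * pole_fun N 0 (- z) -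
        (1 * (deriv (pole_fun N 0) (w z) * pole_fun N 1 (- z)) +
         0 * (deriv (pole_fun N 0) (w z) * pole_fun N 1 (- z)))) (at z)"
      unfolding dmom_integrand[OF z]
    proof (rule DERIV_cong[OF DERIV_mult[OF has_field_derivative_P[OF z]
          DERIV_diff[OF has_field_derivative_inverse_w[OF z'(2)] DERIV_const]]], goal_cases)
      case 1
      show ?case
        unfolding n_def[symmetric] using z' u
        by (simp add: divide_simps) (use u_eq in algebra)
    qed
  qed
  then show ?thesis by simp
qed

end

section \<open>The constant combination of moments\<close>

text \<open>At \<open>u = 0\<close> the bases \<open>1 + 1 / w\<close> and \<open>1 - 1 / z\<close>
  are reciprocal, leaving the residues of \<open>1 / (z - 1)\<close> and
  \<open>- 1 / z\<close>.\<close>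

lemma mom_diff_at_0: "mom N 1 0 0 - mom N 0 1 0 = 1"
proof -
  have P: "pole_fun N 0 (z - 1) * pole_fun N 0 (- z) = 1" if "z \<noteq> 0" "z \<noteq> 1" for z
  proof -
    have "(1 + 1 / (z - 1)) * (1 - 1 / z) = 1"
      using that by (simp add: divide_simps) 
    then show ?thesis
      by (simp add: pole_fun_def power_mult_distrib[symmetric])
  qed
  have ev: "eventually (\<lambda>z. z \<noteq> 0 \<and> z \<noteq> 1) (at (0 :: complex))"
    by (intro eventually_conj eventually_neq_at_within) 
  have "mom N 1 0 0 = residue (\<lambda>z. 1 / (z - 1)) 0"
    unfolding mom_def shift_residue_def
  proof (rule residue_cong)
    show "\<forall>\<^sub>F z in at 0. pole_fun N 1 (0 + z - 1) * pole_fun N 0 (- z) = 1 / (z - 1)"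
      using ev
    proof eventually_elim
      case (elim z)
      then show ?case
        using P[of z] by (subst pole_fun_eq) simp
    qed
  qed auto
  also have "\<dots> = 0"
    by (rule residue_holo[of "- {1}"]) (auto intro!: holomorphic_intros)
  finally have 1: "mom N 1 0 0 = 0" .
  have "mom N 0 1 0 = residue (\<lambda>z. (- 1) / (z - 0)) 0"
    unfolding mom_def shift_residue_def
  proof (rule residue_cong)
    show "\<forall>\<^sub>F z in at 0. pole_fun N 0 (0 + z - 1) * pole_fun N 1 (- z) = (- 1) / (z - 0)"
      using ev
    proof eventually_elim
      case (elim z)
      then show ?case
        using P[of z] by (subst (2) pole_fun_eq) simp
    qed
  qed auto
  also have "\<dots> = - 1"
    by (rule residue_simple[of UNIV]) auto
  finally show ?thesis using 1 by simp
qed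

lemma mom_diff:
  assumes "u \<noteq> 1"
  shows "mom N 1 0 u - mom N 0 1 u = 1"
proof -
  have D: "((\<lambda>u. mom N 1 0 u - mom N 0 1 u) has_field_derivative dmom N 1 0 u - dmom N 0 1 u) (at u)"
    if "u \<noteq> 1" for u
    using that by (intro DERIV_diff has_field_derivative_mom)
  have "connected (- {1 :: complex})"
    by (rule connected_punctured_universe) simp
  moreover have "continuous_on (- {1}) (\<lambda>u. mom N 1 0 u - mom N 0 1 u)"
    using D by (intro continuous_at_imp_continuous_on ballI DERIV_isCont) auto
  \<comment> \<open>\<open>dmom_10\<close> requires \<open>u \<noteq> 0\<close>, so the origin is an
    exceptional point, bridged by continuity.\<close>
  moreover have "\<forall>u \<in> - {1} - {0}. DERIV (\<lambda>u. mom N 1 0 u - mom N 0 1 u) u :> 0"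
    using D dmom_10 by force
  ultimately obtain c where c: "\<And>u. u \<in> - {1} \<Longrightarrow> mom N 1 0 u - mom N 0 1 u = c"
    using DERIV_zero_connected_constant[of "- {1}" "{0}" "\<lambda>u. mom N 1 0 u - mom N 0 1 u"]
    by auto
  have "mom N 1 0 u - mom N 0 1 u = mom N 1 0 0 - mom N 0 1 0"
    using c[of u] c[of 0] assms by simp
  then show ?thesis
    using mom_diff_at_0 by simp
qed

section \<open>The function and its derivatives in terms of two moments\<close>

lemma f_AB_eq_mom:
  assumes u: "u \<notin> {0, 1}"
  shows "f_AB (N + 1) N u = 1 / 2 + mom N 0 0 u + (u - 1) / 2 * mom N 1 1 u"
proof -
  have u01: "u \<noteq> 0" "u \<noteq> 1" using u by auto
  define S where "S = - {1, 1 - u, - u}"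
  define m where "m i j z = pole_fun N 0 (u + z - 1) * pole_fun N 0 (- z) / ((u + z - 1) ^ i * (- z) ^ j)"
    for i j and z :: complex
  have S: "open S" "0 \<in> S"
    using u01 by (auto simp: S_def)
  have m: "m i j holomorphic_on S - {0}" "mom N i j u = residue (m i j) 0" for i j
    using mom_holomorphic[OF u01] mom_eq[OF u01] unfolding m_def[abs_def] S_def by auto
  have "f_AB (N + 1) N u =
      residue (\<lambda>z. (m 0 0 z + (u - 1) / 2 * m 1 1 z) + 1 / 2 * (m 1 0 z - m 0 1 z)) 0"
    unfolding f_AB_def
  proof (rule residue_cong)
    have "eventually (\<lambda>z. z \<in> S - {0}) (at 0)"
      using S by (metis eventually_at_in_open)
    then show "\<forall>\<^sub>F z in at 0. f_integrand (N + 1) N u z =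
        m 0 0 z + (u - 1) / 2 * m 1 1 z + 1 / 2 * (m 1 0 z - m 0 1 z)"
    proof eventually_elim
      case (elim z)
      define w where "w = u + z - 1"
      define P where "P = (1 + 1 / w) ^ N * (1 - 1 / z) ^ N"
      have nz: "w \<noteq> 0" "z \<noteq> 0" and u_eq: "u = w - z + 1"
        using elim by (auto simp: S_def w_def algebra_simps)
      \<comment> \<open>The surplus factor \<open>1 + 1 / w\<close> is split using
        \<open>w - z = u - 1\<close>; the signs reflect that moments use powers of
        \<open>- z\<close>.\<close>
      have "P * (1 + 1 / w) = P + (u - 1) / 2 * (P / (w * - z)) + 1 / 2 * (P / w - P / (- z))"
        using nz unfolding u_eq by (simp add: field_simps)
      then show ?case
        by (simp add: f_integrand_def m_def pole_fun_def flip: w_def) (simp add: P_def mult_ac)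
    qed
  qed auto
  also have "\<dots> = residue (\<lambda>z. m 0 0 z + (u - 1) / 2 * m 1 1 z) 0 +
      residue (\<lambda>z. 1 / 2 * (m 1 0 z - m 0 1 z)) 0"
    by (rule residue_add[OF S]) (intro holomorphic_intros m(1))+
  also have "residue (\<lambda>z. m 0 0 z + (u - 1) / 2 * m 1 1 z) 0 =
      residue (m 0 0) 0 + residue (\<lambda>z. (u - 1) / 2 * m 1 1 z) 0"
    by (rule residue_add[OF S]) (intro holomorphic_intros m(1))+
  also have "residue (\<lambda>z. (u - 1) / 2 * m 1 1 z) 0 = (u - 1) / 2 * residue (m 1 1) 0"
    by (rule residue_lmul[OF S m(1)])
  also have "residue (\<lambda>z. 1 / 2 * (m 1 0 z - m 0 1 z)) 0 = 1 / 2 * residue (\<lambda>z. m 1 0 z - m 0 1 z) 0"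
    by (rule residue_lmul[OF S]) (intro holomorphic_intros m(1))
  also have "residue (\<lambda>z. m 1 0 z - m 0 1 z) 0 = residue (m 1 0) 0 - residue (m 0 1) 0"
    by (rule residue_diff[OF S m(1) m(1)])
  finally show ?thesis
    using mom_diff[of u N] u01 unfolding m(2)[symmetric] by simp
qed

text \<open>After the first-order system is substituted, the denominators \<open>u - 1\<close> and
  \<open>u + 1\<close> cancel.\<close>

lemma has_field_derivative_f_AB:
  assumes u: "u \<in> - {0, 1, -1}"
  shows "(f_AB (N + 1) N has_field_derivative mom N 0 0 u / u - of_nat N * mom N 1 1 u) (at u)"
proof (rule has_field_derivative_transform_within_open[of _ _ _ "- {0, 1, -1}"])
  have u': "u \<noteq> 0" "u \<noteq> 1" "u \<noteq> -1" "u + 1 \<noteq> 0"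
    using u by (auto simp: add_eq_0_iff2)
  show "((\<lambda>u. 1 / 2 + mom N 0 0 u + (u - 1) / 2 * mom N 1 1 u) has_field_derivative
      mom N 0 0 u / u - of_nat N * mom N 1 1 u) (at u)"
  proof (rule DERIV_cong[OF DERIV_add[OF DERIV_add[OF DERIV_const has_field_derivative_mom]
        DERIV_mult[OF _ has_field_derivative_mom]]])
    show "((\<lambda>u. (u - 1) / 2) has_field_derivative 1 / 2) (at u)"
      by (auto intro!: derivative_eq_intros)
    show "0 + dmom N 0 0 u + (1 / 2 * mom N 1 1 u + dmom N 1 1 u * ((u - 1) / 2)) =
        mom N 0 0 u / u - of_nat N * mom N 1 1 u"
      unfolding dmom_00[OF u'(1,2,3)] dmom_11[OF u'(1,2,3)]
      using u'
      by (simp add: divide_simps) algebra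
  qed (rule u'(2))+
qed (use u f_AB_eq_mom in auto)

lemma has_field_derivative_deriv_f_AB:
  assumes u: "u \<in> - {0, 1, -1}"
  shows "(deriv (f_AB (N + 1) N) has_field_derivative
    dmom N 0 0 u / u - mom N 0 0 u / u ^ 2 - of_nat N * dmom N 1 1 u) (at u)"
proof (rule has_field_derivative_transform_within_open[of _ _ _ "- {0, 1, -1}"])
  have u': "u \<noteq> 0" "u \<noteq> 1"
    using u by auto
  show "((\<lambda>u. mom N 0 0 u / u - of_nat N * mom N 1 1 u) has_field_derivative
      dmom N 0 0 u / u - mom N 0 0 u / u ^ 2 - of_nat N * dmom N 1 1 u) (at u)"
    by (rule derivative_eq_intros has_field_derivative_mom u' refl)+
      (use u' in \<open>simp add: divide_simps power2_eq_square\<close>)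
  show "mom N 0 0 v / v - of_nat N * mom N 1 1 v = deriv (f_AB (N + 1) N) v"
    if "v \<in> - {0, 1, -1}" for v
    using DERIV_imp_deriv[OF has_field_derivative_f_AB[OF that]] by simp
qed (use u in auto)

text \<open>As \<open>deriv\<close> is total, the holomorphy conjunct ensures that the equation
  speaks of genuine derivatives.\<close>

theorem lemma3:
  fixes N :: nat
  assumes "N > 0"
  shows "f_AB (N + 1) N holomorphic_on (- {0, 1, -1}) \<and>
    (\<forall>u :: complex. u \<notin> {0, 1, -1} \<longrightarrow>
      (u * of_nat N / (u - 1) + 1 / 2) * deriv (deriv (f_AB (N + 1) N)) u =
        (- 8 * u^2 * (of_nat N)^2 + (- 8 * u^2 + 4 * u) * of_nat N - (u - 1)^2)
            / (2 * u * (u^2 - 1) * (u - 1)) * deriv (f_AB (N + 1) N) u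
        + 2 * of_nat N * (of_nat N + 1) / ((u^2 - 1) * (u - 1)) * f_AB (N + 1) N u
        - of_nat N * (of_nat N + 1) / ((u^2 - 1) * (u - 1)))"
proof (intro conjI allI impI)
  show "f_AB (N + 1) N holomorphic_on (- {0, 1, -1})"
    using has_field_derivative_f_AB by (subst holomorphic_on_open) auto
next
  fix u :: complex assume "u \<notin> {0, 1, -1}"
  then have u: "u \<in> - {0, 1, -1}" and u': "u \<noteq> 0" "u \<noteq> 1" "u \<noteq> -1"
    by auto
  have nz: "u - 1 \<noteq> 0" "u + 1 \<noteq> 0"
    using u' by (auto simp: add_eq_0_iff2)
  have f: "f_AB (N + 1) N u = 1 / 2 + mom N 0 0 u + (u - 1) / 2 * mom N 1 1 u"
    using u by (intro f_AB_eq_mom) auto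
  have f': "deriv (f_AB (N + 1) N) u = mom N 0 0 u / u - of_nat N * mom N 1 1 u"
    by (rule DERIV_imp_deriv[OF has_field_derivative_f_AB[OF u]])
  have f'': "deriv (deriv (f_AB (N + 1) N)) u =
      dmom N 0 0 u / u - mom N 0 0 u / u ^ 2 - of_nat N * dmom N 1 1 u"
    by (rule DERIV_imp_deriv[OF has_field_derivative_deriv_f_AB[OF u]])
  have sq: "u^2 - 1 = (u - 1) * (u + 1)"
    by (simp add: power2_eq_square algebra_simps)
  show "(u * of_nat N / (u - 1) + 1 / 2) * deriv (deriv (f_AB (N + 1) N)) u =
        (- 8 * u^2 * (of_nat N)^2 + (- 8 * u^2 + 4 * u) * of_nat N - (u - 1)^2)
            / (2 * u * (u^2 - 1) * (u - 1)) * deriv (f_AB (N + 1) N) u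
        + 2 * of_nat N * (of_nat N + 1) / ((u^2 - 1) * (u - 1)) * f_AB (N + 1) N u
        - of_nat N * (of_nat N + 1) / ((u^2 - 1) * (u - 1))"
    \<comment> \<open>Everything is now affine in \<open>mom N 0 0 u\<close> and
      \<open>mom N 1 1 u\<close>, whose coefficients balance separately; the constant
      \<open>1 / 2\<close> in \<open>f\<close> accounts for the inhomogeneous term.\<close>
    unfolding f f' f'' dmom_00[OF u'] dmom_11[OF u'] sq
    using u'(1) nz by (simp add: divide_simps) algebra
qed

end
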